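(* Let $0<a_1<a_2<a_3$ and $e_1,e_2,e_3\ge 1$ be integers, and let $Y$ be the Young diagram consisting of exactly $e_i$ rows of length $a_i$ for $i=1,2,3$. If $Y$ is wide, then $Y$ has an allocation.
   Context: A Young diagram is a left-aligned array of cells with rows ordered by length, longest at the top. The conjugate of a Young diagram is obtained by interchanging rows and columns. A Young diagram $A$ dominates a Young diagram $B$ with the same number of cells if, for every $w\ge 1$, the sum of the $w$ largest row lengths of $A$ is at least the sum of the $w$ largest row lengths of $B$ (missing rows count as length $0$). Wide: $Y$ is wide if, for every subset of the rows of $Y$, the Young diagram formed by those rows dominates its conjugate. Allocation: for a Young diagram with $e_i$ rows of length $a_i$ ($1\le i\le p$, $a_1<\cdots<a_p$; here $p=3$), put $a_0=0$ and $b_i=a_i-a_{i-1}$ for $1\le i\le p$. An allocation is a collection of nonnegative integers $z_{ijk}$, indexed by triples with $1\le j\le i\le p$ and $1\le k\le i$, satisfying $$\sum_{k=1}^i z_{ijk}=e_ib_j\quad\text{for } 1\le j\le i\le p,$$ $$\sum_{j=1}^i z_{ijk}=e_ib_k\quad\text{for } 1\le k\le i\le p,$$ $$\sum_{i=\max(j,k)}^p z_{ijk}\le b_jb_k\quad\text{for } 1\le j,k\le p.$$ *)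

theory Defs
  imports Main "HOL-Library.Multiset"
begin

text \<open>A Young diagram is given by its list of (positive) row lengths, longest row first.\<close>

definition young_diagram :: "nat list \<Rightarrow> bool" where
  "young_diagram Y \<longleftrightarrow> sorted_wrt (\<ge>) Y \<and> (\<forall>r\<in>set Y. 0 < r)"

definition cells :: "nat list \<Rightarrow> (nat \<times> nat) set" where
  "cells Y = {(r, c). r < length Y \<and> c < Y ! r}"

text \<open>Row \<open>c\<close> of the conjugate (counting from \<open>0\<close>) is column \<open>c\<close> of \<open>Y\<close>, whose cells lie in the
  rows of length greater than \<open>c\<close>; there are as many columns as cells in the first row. Lemma
  \<open>cells_conjugate\<close> below confirms that this interchanges rows and columns.\<close>

definition conjugate :: "nat list \<Rightarrow> nat list" where
  "conjugate Y = map (\<lambda>c. length (filter (\<lambda>r. c < r) Y)) [0..<(if Y = [] then 0 else hd Y)]"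

text \<open>On Young diagrams the \<open>w\<close> largest row lengths are the first \<open>w\<close> entries of the list, and
  \<open>take\<close> treats missing rows as having length \<open>0\<close>.\<close>

definition dominates :: "nat list \<Rightarrow> nat list \<Rightarrow> bool" where
  "dominates A B \<longleftrightarrow> sum_list A = sum_list B \<and>
     (\<forall>w\<ge>1. sum_list (take w B) \<le> sum_list (take w A))"

text \<open>A subset of the rows is a set \<open>R\<close> of row positions, so equally long rows are distinguished.\<close>

definition wide :: "nat list \<Rightarrow> bool" where
  "wide Y \<longleftrightarrow> (\<forall>R \<subseteq> {..<length Y}. dominates (nths Y R) (conjugate (nths Y R)))"

text \<open>The differences \<open>b\<^sub>i = a\<^sub>i - a\<^sub>i\<^sub>-\<^sub>1\<close> for \<open>i \<ge> 1\<close>, where \<open>a\<^sub>0 = 0\<close> whatever the value \<open>a 0\<close>.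
  Natural subtraction does not truncate here, since \<open>a\<close> is increasing on the relevant range.\<close>

definition row_step :: "(nat \<Rightarrow> nat) \<Rightarrow> nat \<Rightarrow> nat" where
  "row_step a i = a i - (if i = 1 then 0 else a (i - 1))"

text \<open>Only the values \<open>z i j k\<close> with \<open>1 \<le> j \<le> i \<le> p\<close> and \<open>1 \<le> k \<le> i\<close> matter.\<close>

definition is_allocation ::
    "nat \<Rightarrow> (nat \<Rightarrow> nat) \<Rightarrow> (nat \<Rightarrow> nat) \<Rightarrow> (nat \<Rightarrow> nat \<Rightarrow> nat \<Rightarrow> nat) \<Rightarrow> bool" where
  "is_allocation p a e z \<longleftrightarrow>
     (\<forall>i j. 1 \<le> j \<and> j \<le> i \<and> i \<le> p \<longrightarrow> (\<Sum>k=1..i. z i j k) = e i * row_step a j) \<and>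
     (\<forall>i k. 1 \<le> k \<and> k \<le> i \<and> i \<le> p \<longrightarrow> (\<Sum>j=1..i. z i j k) = e i * row_step a k) \<and>
     (\<forall>j k. 1 \<le> j \<and> j \<le> p \<and> 1 \<le> k \<and> k \<le> p \<longrightarrow>
        (\<Sum>i=max j k..p. z i j k) \<le> row_step a j * row_step a k)"

lemma young_diagram_nths:
  assumes "young_diagram Y"
  shows "young_diagram (nths Y R)"
proof -
  have "sorted_wrt (\<ge>) (nths Y R)" if "sorted_wrt (\<ge>) Y"
    using that
  proof (induction Y arbitrary: R)
    case (Cons y Y)
    then show ?case
      by (auto simp: nths_Cons dest: in_set_nthsD)
  qed simp
  then show ?thesis
    using assms by (auto simp: young_diagram_def dest: in_set_nthsD)
qed

lemma less_length_filter_iff: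
  fixes Y :: "nat list"
  assumes "sorted_wrt (\<ge>) Y"
  shows "r < length (filter (\<lambda>s. c < s) Y) \<longleftrightarrow> r < length Y \<and> c < Y ! r"
  using assms
proof (induction Y arbitrary: r)
  case (Cons y Y)
  show ?case
  proof (cases "c < y")
    case True
    then show ?thesis
      using Cons by (cases r) auto
  next
    case False
    then have "\<forall>s\<in>set (y # Y). \<not> c < s"
      using Cons.prems by auto
    then show ?thesis
      using nth_mem[of r "y # Y"] by (auto simp: filter_empty_conv)
  qed
qed simp

lemma cells_conjugate:
  assumes "young_diagram Y"
  shows "cells (conjugate Y) = prod.swap ` cells Y"
proof -
  have *: "sorted_wrt (\<ge>) Y"
    using assms by (simp add: young_diagram_def)
  have "c < (if Y = [] then 0 else hd Y)" if "r < length Y" "c < Y ! r" for r c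
  proof (cases Y)
    case (Cons y ys)
    then have "Y ! r \<le> y"
      using * that by (cases r) auto
    then show ?thesis
      using that Cons by simp
  qed (use that in simp)
  then show ?thesis
    by (force simp: cells_def conjugate_def less_length_filter_iff[OF *] image_iff
        split: if_split_asm)
qed

lemma young_diagram_conjugate:
  assumes "young_diagram Y"
  shows "young_diagram (conjugate Y)"
proof -
  have "length (filter (\<lambda>r. d < r) Y) \<le> length (filter (\<lambda>r. c < r) Y)" if "c \<le> d" for c d
    using that by (induction Y) auto
  then show ?thesis
    by (auto simp: young_diagram_def conjugate_def sorted_wrt_iff_nth_less filter_empty_conv
        intro!: bexI[of _ "hd Y"])
qed

end

theory Submission imports Defs begin

text \<open>
  Let \<open>b j = row_step a j\<close>. An allocation packs three layers \<open>i = 1, 2, 3\<close> into blocks of capacity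
  \<open>b j * b k\<close>, the \<open>i\<close>-th layer being an \<open>i \<times> i\<close> nonnegative integer matrix with row and
  column sums \<open>e i * b j\<close>. Layer 1 is forced. Layer 2 has one free parameter, its off-diagonal
  entry \<open>y\<close>. Once \<open>y\<close> is fixed, layer 3 is an ordinary transportation problem with capacities
  \<open>b j * b k\<close> minus what layers 1 and 2 use, so it has an integral solution as soon as no cut
  \<open>I \<times> J\<close> is overloaded (\<open>integral_transport_exists\<close>).

  The capacity of a cut \<open>I \<times> J\<close> depends on \<open>y\<close> only if \<open>I\<close> and \<open>J\<close> each contain exactly one of the
  indices 1 and 2: it grows with \<open>y\<close> if they contain the same one and shrinks otherwise. Since there
  are at most \<open>a 3\<close> rows, the shrinking cuts tolerate every \<open>y \<le> b 1 * b 2\<close>. Nonnegativity of layer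
  2 requires \<open>y \<le> e 2 * b 1\<close> and \<open>y \<le> e 2 * b 2\<close>. So \<open>y\<close> is taken to be the minimum of these three
  bounds, and every other cut condition becomes an inequality between the \<open>e i\<close> and the \<open>b j\<close>.

  Wideness supplies these inequalities. Discarding the rows longer than \<open>w + v\<close> and comparing the
  first \<open>w\<close> rows of the rest with its first \<open>w\<close> columns gives, for all \<open>w\<close> and \<open>v\<close>, a bound on the
  sum over all rows \<open>r\<close> of the positive part of \<open>min w r + min v r - r\<close> by \<open>w * v\<close>
  (\<open>wide_rectangle_bound\<close>). Four choices of \<open>(w, v)\<close> suffice: \<open>(a 1, a 1)\<close>, \<open>(a 1, a 2)\<close>,
  \<open>(a 2, a 2)\<close> and \<open>(1, a 3)\<close>. The lemmas \<open>first_step_bounds\<close> and \<open>second_step_bounds\<close> deduce from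
  them the conditions for the cuts that grow with \<open>y\<close>: those through the block \<open>(1, 1)\<close> and those
  through \<open>(2, 2)\<close> respectively. The remaining cuts need little more than the four bounds
  themselves.
\<close>

section \<open>Integral transportation with capacities\<close>

lemma sum_fun_upd:
  fixes f :: "'a \<Rightarrow> int"
  assumes "finite S"
  shows "sum (f(p := v)) S = sum f S + (if p \<in> S then v - f p else 0)"
proof (cases "p \<in> S")
  case True
  then have "sum (f(p := v)) S = v + sum (f(p := v)) (S - {p})" "sum f S = f p + sum f (S - {p})"
    using assms by (simp_all add: sum.remove)
  moreover have "sum (f(p := v)) (S - {p}) = sum f (S - {p})"
    by (rule sum.cong) auto
  ultimately show ?thesis using True by simp
next
  case False
  then have "sum (f(p := v)) S = sum f S"
    by (intro sum.cong) auto
  then show ?thesis using False by simp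
qed

text \<open>
  Uncrossing: of the four rectangles, the two on the left cover every cell at most as often as the
  two on the right; moreover the left ones miss the cell \<open>(i, j)\<close>, which lies in \<open>I \<times> J\<close>.
\<close>

lemma cross_capacity:
  fixes c :: "'a \<times> 'b \<Rightarrow> nat"
  assumes "finite I" "finite J" "finite I'" "finite J'"
    and "i \<in> I" "j \<in> J" "i \<notin> I'" "j \<notin> J'"
  shows "sum c ((I \<inter> I') \<times> (J \<union> J')) + sum c ((I \<union> I') \<times> (J \<inter> J')) + c (i, j)
    \<le> sum c (I \<times> J) + sum c (I' \<times> J')"
proof -
  let ?P = "(I \<inter> I') \<times> (J \<union> J')" and ?Q = "(I \<union> I') \<times> (J \<inter> J')"
  have "sum c ?P + sum c ?Q + c (i, j) = sum c (?P \<union> ?Q) + sum c (?P \<inter> ?Q) + c (i, j)"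
    using assms by (simp add: sum.union_inter)
  also have "\<dots> = sum c (insert (i, j) (?P \<union> ?Q)) + sum c (?P \<inter> ?Q)"
    using assms by simp
  also have "\<dots> \<le> sum c (I \<times> J \<union> I' \<times> J') + sum c (I \<times> J \<inter> I' \<times> J')"
    using assms by (intro add_mono sum_mono2) auto
  also have "\<dots> = sum c (I \<times> J) + sum c (I' \<times> J')"
    using assms by (simp add: sum.union_inter)
  finally show ?thesis .
qed

text \<open>
  This is the feasibility criterion for transportation problems with integral data. The proof
  settles one unit of capacity at a time. At a cell \<open>(i, j)\<close> of positive capacity there are two
  ways to use up a unit: give it away unused, which breaks a cut condition only at a tight cut with
  \<open>i \<in> I\<close> and \<open>j \<in> J\<close>, or ship one unit from \<open>i\<close> to \<open>j\<close>, which breaks one only at a tight cut with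
  \<open>i \<notin> I\<close> and \<open>j \<notin> J\<close>. Tight cuts of both kinds cannot coexist, since uncrossing them would
  overload one of the two resulting cuts.
\<close>

lemma integral_transport_exists:
  fixes s :: "'a \<Rightarrow> int" and d :: "'b \<Rightarrow> int" and c :: "'a \<times> 'b \<Rightarrow> nat"
  assumes fin: "finite A" "finite B"
    and "sum s A = sum d B"
    and "\<And>I J. I \<subseteq> A \<Longrightarrow> J \<subseteq> B \<Longrightarrow> sum s I \<le> int (sum c (I \<times> J)) + sum d (B - J)"
  shows "\<exists>x. (\<forall>i\<in>A. \<forall>j\<in>B. x i j \<le> c (i, j)) \<and>
    (\<forall>i\<in>A. int (\<Sum>j\<in>B. x i j) = s i) \<and> (\<forall>j\<in>B. int (\<Sum>i\<in>A. x i j) = d j)"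
  using assms(3,4)
proof (induction "sum c (A \<times> B)" arbitrary: c s d rule: less_induct)
  case less
  note total = less.prems(1) and cut = less.prems(2)
  show ?case
  proof (cases "sum c (A \<times> B) = 0")
    case True
    then have c0: "sum c (I \<times> J) = 0" if "I \<subseteq> A" "J \<subseteq> B" for I J
      using that fin by (subst sum_eq_0_iff) (auto dest: finite_subset)
    \<comment> \<open>Cuts isolating one index from its side bound each supply and demand from both sides by \<open>0\<close>.\<close>
    have "s i = 0" if "i \<in> A" for i
    proof -
      have "s i \<le> 0"
        using cut[of "{i}" B] c0[of "{i}" B] that by simp
      moreover have "sum s A - s i \<le> sum d B"
        using cut[of "A - {i}" "{}"] that fin by (simp add: sum_diff1)
      ultimately show ?thesis using total by simp
    qed
    moreover have "d j = 0" if "j \<in> B" for j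
    proof -
      have "sum s A \<le> sum d B - d j"
        using cut[of A "{j}"] c0[of A "{j}"] that fin by (simp add: sum_diff1)
      moreover have "0 \<le> d j"
        using cut[of "{}" "B - {j}"] that by (simp add: double_diff)
      ultimately show ?thesis using total by simp
    qed
    ultimately show ?thesis
      by (intro exI[of _ "\<lambda>_ _. 0"]) auto
  next
    case False
    then obtain i j where ij: "i \<in> A" "j \<in> B" "c (i, j) > 0"
      using fin by auto
    define c' where "c' = c((i, j) := c (i, j) - 1)"
    have c'_sum: "int (sum c' (I \<times> J)) = int (sum c (I \<times> J)) - (if i \<in> I \<and> j \<in> J then 1 else 0)"
      if "I \<subseteq> A" "J \<subseteq> B" for I J
    proof -
      have "finite (I \<times> J)" using that fin by (auto intro: finite_subset)
      moreover have "(\<lambda>p. int (c' p)) = (\<lambda>p. int (c p))((i, j) := int (c (i, j)) - 1)"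
        using ij by (auto simp: c'_def)
      ultimately show ?thesis
        by (simp only: of_nat_sum sum_fun_upd) auto
    qed
    have dec: "sum c' (A \<times> B) < sum c (A \<times> B)"
      using c'_sum[of A B] ij by (simp del: of_nat_sum)
    have "(\<forall>I J. I \<subseteq> A \<longrightarrow> J \<subseteq> B \<longrightarrow> i \<in> I \<longrightarrow> j \<in> J \<longrightarrow>
        sum s I \<noteq> int (sum c (I \<times> J)) + sum d (B - J)) \<or>
      (\<forall>I J. I \<subseteq> A \<longrightarrow> J \<subseteq> B \<longrightarrow> i \<notin> I \<longrightarrow> j \<notin> J \<longrightarrow>
        sum s I \<noteq> int (sum c (I \<times> J)) + sum d (B - J))"
    proof (rule ccontr)
      assume "\<not> ?thesis"
      then obtain I J I' J' where sub: "I \<subseteq> A" "J \<subseteq> B" "I' \<subseteq> A" "J' \<subseteq> B"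
        and mem: "i \<in> I" "j \<in> J" "i \<notin> I'" "j \<notin> J'"
        and tight: "sum s I = int (sum c (I \<times> J)) + sum d (B - J)"
          "sum s I' = int (sum c (I' \<times> J')) + sum d (B - J')"
        by blast
      have fins: "finite I" "finite J" "finite I'" "finite J'"
        using sub fin by (auto intro: finite_subset)
      have "sum s (I \<inter> I') + sum s (I \<union> I') = sum s I + sum s I'"
        using fins sum.union_inter[of I I' s] by simp
      moreover have "sum d (B - (J \<union> J')) + sum d (B - (J \<inter> J')) = sum d (B - J) + sum d (B - J')"
        using fin sum.union_inter[of "B - J" "B - J'" d]
        by (simp add: Diff_Un Diff_Int)
      moreover have "sum s (I \<inter> I') \<le>
          int (sum c ((I \<inter> I') \<times> (J \<union> J'))) + sum d (B - (J \<union> J'))"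
        using sub by (intro cut) auto
      moreover have "sum s (I \<union> I') \<le>
          int (sum c ((I \<union> I') \<times> (J \<inter> J'))) + sum d (B - (J \<inter> J'))"
        using sub by (intro cut) auto
      ultimately show False
        using cross_capacity[OF fins mem, of c] ij tight by linarith
    qed
    then show ?thesis
    proof
      assume slack: "\<forall>I J. I \<subseteq> A \<longrightarrow> J \<subseteq> B \<longrightarrow> i \<in> I \<longrightarrow> j \<in> J \<longrightarrow>
        sum s I \<noteq> int (sum c (I \<times> J)) + sum d (B - J)"
      have "sum s I \<le> int (sum c' (I \<times> J)) + sum d (B - J)" if "I \<subseteq> A" "J \<subseteq> B" for I J
      proof (cases "i \<in> I \<and> j \<in> J")
        case True
        then have "sum s I \<noteq> int (sum c (I \<times> J)) + sum d (B - J)"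
          using slack that by blast
        then show ?thesis using cut[OF that] c'_sum[OF that] True by (simp del: of_nat_sum)
      next
        case False
        then show ?thesis using cut[OF that] c'_sum[OF that] by (simp only: if_False)
      qed
      from less.hyps[OF dec total this] obtain x
        where x: "\<forall>i\<in>A. \<forall>j\<in>B. x i j \<le> c' (i, j)" "\<forall>i\<in>A. int (\<Sum>j\<in>B. x i j) = s i"
          "\<forall>j\<in>B. int (\<Sum>i\<in>A. x i j) = d j"
        by blast
      have "c' p \<le> c p" for p by (simp add: c'_def)
      then have "\<forall>i\<in>A. \<forall>j\<in>B. x i j \<le> c (i, j)"
        using x(1) order_trans by blast
      with x(2,3) show ?thesis by blast
    next
      assume slack: "\<forall>I J. I \<subseteq> A \<longrightarrow> J \<subseteq> B \<longrightarrow> i \<notin> I \<longrightarrow> j \<notin> J \<longrightarrow>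
        sum s I \<noteq> int (sum c (I \<times> J)) + sum d (B - J)"
      define s' where "s' = s(i := s i - 1)"
      define d' where "d' = d(j := d j - 1)"
      have s'_sum: "sum s' I = sum s I - (if i \<in> I then 1 else 0)" if "I \<subseteq> A" for I
        using sum_fun_upd[of I s i "s i - 1"] that fin
        by (auto simp: s'_def dest: finite_subset)
      have d'_sum: "sum d' J = sum d J - (if j \<in> J then 1 else 0)" if "J \<subseteq> B" for J
        using sum_fun_upd[of J d j "d j - 1"] that fin
        by (auto simp: d'_def dest: finite_subset)
      have cut': "sum s' I \<le> int (sum c' (I \<times> J)) + sum d' (B - J)" if "I \<subseteq> A" "J \<subseteq> B" for I J
      proof (cases "i \<notin> I \<and> j \<notin> J")
        case True
        then have "sum s I \<noteq> int (sum c (I \<times> J)) + sum d (B - J)"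
          using slack that by blast
        then show ?thesis
          using cut[OF that] c'_sum[OF that] s'_sum[OF that(1)] d'_sum[of "B - J"] True ij
          by (simp del: of_nat_sum)
      next
        case False
        then show ?thesis
          using cut[OF that] c'_sum[OF that] s'_sum[OF that(1)] d'_sum[of "B - J"] ij
          by (auto simp del: of_nat_sum split: if_splits)
      qed
      have "sum s' A = sum d' B"
        using total s'_sum[of A] d'_sum[of B] ij by simp
      from less.hyps[OF dec this cut'] obtain x
        where x: "\<forall>i\<in>A. \<forall>j\<in>B. x i j \<le> c' (i, j)" "\<forall>i\<in>A. int (\<Sum>j\<in>B. x i j) = s' i"
          "\<forall>j\<in>B. int (\<Sum>i\<in>A. x i j) = d' j"
        by blast
      define x' where "x' = (\<lambda>k l. x k l + (if k = i \<and> l = j then 1 else 0))"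
      have "x' k l \<le> c (k, l)" if "k \<in> A" "l \<in> B" for k l
      proof -
        have "x k l \<le> c' (k, l)" using x(1) that by blast
        then show ?thesis using ij by (auto simp: x'_def c'_def split: if_splits)
      qed
      moreover have "int (\<Sum>l\<in>B. x' k l) = s k" if "k \<in> A" for k
      proof -
        have "(\<Sum>l\<in>B. x' k l) = (\<Sum>l\<in>B. x k l) + (\<Sum>l\<in>B. if l = j then if k = i then 1 else 0 else 0)"
          unfolding x'_def sum.distrib[symmetric] by (intro sum.cong) auto
        also have "\<dots> = (\<Sum>l\<in>B. x k l) + (if k = i then 1 else 0)"
          using ij fin by simp
        finally show ?thesis
          using bspec[OF x(2) that] by (auto simp: s'_def)
      qed
      moreover have "int (\<Sum>k\<in>A. x' k l) = d l" if "l \<in> B" for l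
      proof -
        have "(\<Sum>k\<in>A. x' k l) = (\<Sum>k\<in>A. x k l) + (\<Sum>k\<in>A. if k = i then if l = j then 1 else 0 else 0)"
          unfolding x'_def sum.distrib[symmetric] by (intro sum.cong) auto
        also have "\<dots> = (\<Sum>k\<in>A. x k l) + (if l = j then 1 else 0)"
          using ij fin by simp
        finally show ?thesis
          using bspec[OF x(3) that] by (auto simp: d'_def)
      qed
      ultimately show ?thesis by (intro exI[of _ x']) simp
    qed
  qed
qed

section \<open>Wideness bounds rectangles\<close>

text \<open>Both sides count the cells of \<open>Z\<close> in its first \<open>m\<close> columns.\<close>

lemma sum_list_length_filter_less:
  fixes Z :: "nat list"
  shows "(\<Sum>c\<leftarrow>[0..<m]. length (filter (\<lambda>r. c < r) Z)) = (\<Sum>r\<leftarrow>Z. min m r)"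
proof (induction Z)
  case (Cons r Z)
  have "(\<Sum>c\<leftarrow>[0..<m]. (if c < r then 1 else 0)) = min m r"
    by (induction m) auto
  moreover have "length (filter (\<lambda>r. c < r) (r # Z)) =
    (if c < r then 1 else 0) + length (filter (\<lambda>r. c < r) Z)" for c by simp
  ultimately show ?case
    using Cons by (simp add: sum_list_addf del: filter.simps)
qed simp

lemma sum_list_take_conjugate:
  assumes "young_diagram Z"
  shows "sum_list (take w (conjugate Z)) = (\<Sum>r\<leftarrow>Z. min w r)"
proof (cases Z)
  case (Cons z zs)
  then have le: "r \<le> hd Z" if "r \<in> set Z" for r
    using assms that by (auto simp: young_diagram_def)
  have "take w (conjugate Z) = map (\<lambda>c. length (filter (\<lambda>r. c < r) Z)) [0..<min w (hd Z)]"
    using Cons by (simp add: conjugate_def take_map take_upt min_def)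
  then have "sum_list (take w (conjugate Z)) = (\<Sum>r\<leftarrow>Z. min (min w (hd Z)) r)"
    by (simp add: sum_list_length_filter_less)
  also have "\<dots> = (\<Sum>r\<leftarrow>Z. min w r)"
    using le by (intro arg_cong[of _ _ sum_list] map_cong) (auto simp: min_def dest: le)
  finally show ?thesis .
qed (simp add: conjugate_def)

text \<open>Each of the \<open>w\<close> entries is at most \<open>v\<close> plus its truncated excess over \<open>v\<close>.\<close>

lemma sum_list_take_le:
  fixes Z :: "nat list"
  shows "sum_list (take w Z) \<le> w * v + (\<Sum>r\<leftarrow>Z. r - v)"
proof (induction Z arbitrary: w)
  case (Cons r Z)
  show ?case
  proof (cases w)
    case (Suc u)
    moreover have "r \<le> v + (r - v)" by simp
    ultimately show ?thesis
      using add_mono[OF _ Cons.IH[of u], of r "v + (r - v)"] by (simp add: algebra_simps)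
  qed simp
qed simp

text \<open>
  Let \<open>Z\<close> consist of the rows \<open>r \<le> w + v\<close>; these include all rows that contribute to the truncated
  sum. The first \<open>w\<close> columns of \<open>Z\<close> have \<open>min w r\<close> cells in the row \<open>r\<close>, and the first \<open>w\<close> rows of
  \<open>Z\<close> have at most \<open>w * v\<close> cells plus all excesses \<open>r - v\<close>. Since \<open>Z\<close> dominates its conjugate, the
  sum over \<open>Z\<close> of \<open>min w r - (r - v) = min w r + min v r - r\<close> is at most \<open>w * v\<close>.
\<close>

lemma wide_rectangle_bound:
  assumes "young_diagram Y" and "wide Y"
  shows "(\<Sum>r\<leftarrow>Y. min w r + min v r - r) \<le> w * v"
proof (cases "w = 0")
  case True
  then have "map (\<lambda>r. min w r + min v r - r) Y = map (\<lambda>r. 0) Y" by simp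
  then show ?thesis by (simp add: True)
next
  case False
  define R where "R = {i. i < length Y \<and> Y ! i \<le> w + v}"
  define Z where "Z = nths Y R"
  have Z: "Z = filter (\<lambda>r. r \<le> w + v) Y"
    by (simp add: Z_def R_def filter_eq_nths)
  have "dominates Z (conjugate Z)"
    using assms(2) unfolding wide_def Z_def by (elim allE[of _ R]) (auto simp: R_def)
  then have "sum_list (take w (conjugate Z)) \<le> sum_list (take w Z)"
    using False by (simp add: dominates_def)
  then have "(\<Sum>r\<leftarrow>Z. min w r) \<le> w * v + (\<Sum>r\<leftarrow>Z. r - v)"
    using sum_list_take_conjugate[of Z w] sum_list_take_le[of w Z v]
      young_diagram_nths[OF assms(1), of R] by (simp add: Z_def)
  moreover have "(\<Sum>r\<leftarrow>Z. min w r) = (\<Sum>r\<leftarrow>Z. (min w r + min v r - r) + (r - v))"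
    by (intro arg_cong[of _ _ sum_list] map_cong) (auto simp: Z)
  moreover have "(\<Sum>r\<leftarrow>Z. min w r + min v r - r) = (\<Sum>r\<leftarrow>Y. min w r + min v r - r)"
    unfolding Z by (induction Y) auto
  ultimately show ?thesis by (simp add: sum_list_addf)
qed

section \<open>Inequalities for the steps\<close>

text \<open>
  The hypotheses \<open>W11\<close> and \<open>W12\<close> are the rectangle bounds for \<open>(a 1, a 1)\<close> and \<open>(a 1, a 2)\<close> in terms
  of the steps, and \<open>W13\<close> says that there are at most \<open>a 3\<close> rows. The conclusions say that the cuts
  \<open>{1} \<times> {1}\<close> and, with \<open>t = 0\<close> and \<open>t = b3\<close>, the cuts \<open>{1} \<times> {1, 3}\<close> and \<open>{1, 3} \<times> {1, 3}\<close> of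
  the third layer are not overloaded. The parameter \<open>t\<close> treats the last two at once. For
  fixed steps everything is linear in \<open>e1\<close>, \<open>e2\<close>, \<open>e3\<close>, and each case below is settled by adding
  up hypotheses with suitable nonnegative multipliers that depend on the steps.
\<close>

lemma first_step_bounds:
  fixes b1 b2 b3 e1 e2 e3 y :: int
  assumes pos: "0 < b1" "0 < b2" "0 < b3" "0 \<le> e1" "0 \<le> e2" "0 \<le> e3"
    and W13: "e1 + e2 + e3 \<le> b1 + b2 + b3"
    and W11: "e1 * b1 + e2 * max 0 (b1 - b2) + e3 * max 0 (b1 - b2 - b3) \<le> b1 * b1"
    and W12: "(e1 + e2) * b1 + e3 * max 0 (b1 - b3) \<le> b1 * (b1 + b2)"
    and y: "y = b1 * b2 \<or> y = e2 * min b1 b2"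
  shows "(e1 + e2) * b1 + e3 * max 0 (b1 - b2 - b3) \<le> b1 * b1 + y"
    and "0 \<le> t \<Longrightarrow> t \<le> b3 \<Longrightarrow> (e1 + e2) * b1 + e3 * (b1 + t - b2) \<le> (b1 + t) * (b1 + b3) + y"
proof -
  define u where "u = max 0 (b1 - b2)"
  define c where "c = max 0 (b1 - b2 - b3)"
  have W: "e1 * b1 + e2 * u + e3 * c \<le> b1 * b1" using W11 by (simp add: u_def c_def)
  \<comment> \<open>In the second case \<open>y\<close> leaves exactly the coefficient that \<open>e2\<close> has in \<open>W11\<close>.\<close>
  have y: "y = b1 * b2 \<or> e2 * b1 = e2 * u + y"
    using y by (auto simp: u_def min_def max_def algebra_simps)
  have "e3 * c \<le> e3 * max 0 (b1 - b3)"
    using pos unfolding c_def by (intro mult_left_mono) auto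
  then show "(e1 + e2) * b1 + e3 * c \<le> b1 * b1 + y"
    using y W W12 by (auto simp: algebra_simps)

  assume t: "0 \<le> t" "t \<le> b3"
  have b1W: "b1 * (e1 + e2 + e3) \<le> b1 * (b1 + b2 + b3)"
    using W13 pos by (intro mult_left_mono) auto
  have large: "(e1 + e2) * b1 + e3 * (b1 + t - b2) \<le> (b1 + t) * (b1 + b3)" if "b2 \<le> t"
  proof -
    have "(t - b2) * e3 \<le> (t - b2) * (b1 + b2 + b3)"
      using W13 pos that by (intro mult_left_mono) auto
    moreover have "0 \<le> b2 * (b2 + b3 - t)" using pos t by simp
    ultimately show ?thesis using b1W by (simp add: algebra_simps)
  qed
  show "(e1 + e2) * b1 + e3 * (b1 + t - b2) \<le> (b1 + t) * (b1 + b3) + y"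
    using y
  proof
    assume y: "y = b1 * b2"
    show ?thesis
    proof (cases "b2 \<le> t")
      case True
      then show ?thesis using large y pos mult_pos_pos[of b1 b2] by linarith
    next
      case False
      then have "0 \<le> e3 * (b2 - t)" "0 \<le> t * (b1 + b3)" using pos t by simp_all
      then show ?thesis using b1W y by (simp only: algebra_simps)
    qed
  next
    assume y: "e2 * b1 = e2 * u + y"
    have u: "0 \<le> e2 * u" "u \<le> b1" using pos by (auto simp: u_def)
    have "e1 * b1 + e2 * u + e3 * (b1 + t - b2) \<le> (b1 + t) * (b1 + b3)"
    \<comment> \<open>If \<open>e3 \<le> b1\<close>, adding \<open>(b3 + t) * e3 \<le> (b3 + t) * b1\<close> to \<open>W11\<close> suffices. Otherwise \<open>W13\<close>
      leaves at most \<open>b2 + b3\<close> rows of the two shorter lengths, and \<open>W13\<close> combines with that.\<close>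
    proof (cases "e3 \<le> b1")
      case True
      then have "e3 * (b3 + t) \<le> b1 * (b3 + t)" using pos t by (intro mult_right_mono) auto
      moreover have "e3 * (b1 - b2 - b3) \<le> e3 * c"
        using pos by (intro mult_left_mono) (auto simp: c_def)
      moreover have "0 \<le> t * b3" using t pos by simp
      ultimately show ?thesis
        using W by (simp only: algebra_simps; linarith)
    next
      case False
      then have e12: "e1 + e2 \<le> b2 + b3" using W13 by simp
      consider "b2 \<le> t" | "t < b2" "b2 \<le> b1 + t" | "b1 + t < b2" by linarith
      then show ?thesis
      proof cases
        case 1
        have "e2 * u \<le> e2 * b1" using u pos by (intro mult_left_mono) auto
        then show ?thesis using large[OF 1] by (simp only: algebra_simps; linarith)
      next
        case 2
        have "(b1 + t - b2) * (e1 + e2 + e3) \<le> (b1 + t - b2) * (b1 + b2 + b3)"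
          using W13 2 by (intro mult_left_mono) auto
        moreover have "(b2 - t) * e1 \<le> (b2 - t) * (b2 + b3)"
          using e12 2 pos by (intro mult_left_mono) auto
        moreover have "e2 * u \<le> e2 * (b1 + t - b2)"
          using 2 pos t by (intro mult_left_mono) (auto simp: u_def)
        moreover have "0 \<le> t * b3" using t pos by simp
        ultimately show ?thesis by (simp only: algebra_simps; linarith)
      next
        case 3
        then have "0 \<le> e3 * (b2 - b1 - t)" using pos by simp
        moreover have "0 \<le> e3 * c" "0 \<le> b1 * b3" "0 \<le> t * (b1 + b3)"
          using pos t by (auto simp: c_def)
        ultimately show ?thesis using W by (simp only: algebra_simps; linarith)
      qed
    qed
    then show ?thesis using y by (simp add: algebra_simps)
  qed
qed

text \<open>
  The counterpart for index 2, with the rectangle bound \<open>W22\<close> for \<open>(a 2, a 2)\<close> (weakened by dropping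
  the rows of length \<open>a 1\<close>) and the bound \<open>W23\<close> on the number of longer rows. The first conclusion is
  the cut \<open>{2} \<times> {1, 2}\<close>, in which \<open>y\<close> cancels; the others are \<open>{2} \<times> {2}\<close> and, with \<open>t = 0\<close> and
  \<open>t = b3\<close>, the cuts \<open>{2} \<times> {2, 3}\<close> and \<open>{2, 3} \<times> {2, 3}\<close>.
\<close>

lemma second_step_bounds:
  fixes b1 b2 b3 e2 e3 y :: int
  assumes pos: "0 < b1" "0 < b2" "0 < b3" "0 \<le> e2" "0 \<le> e3"
    and W23: "e2 + e3 \<le> b1 + b2 + b3"
    and W22: "e2 * (b1 + b2) + e3 * max 0 (b1 + b2 - b3) \<le> (b1 + b2) * (b1 + b2)"
    and y: "y = b1 * b2 \<or> y = e2 * min b1 b2"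
  shows "e2 * b2 + e3 * max 0 (b2 - b3) \<le> b2 * (b1 + b2)"
    and "e2 * b2 + e3 * max 0 (b2 - b1 - b3) \<le> b2 * b2 + y"
    and "0 \<le> t \<Longrightarrow> t \<le> b3 \<Longrightarrow> e2 * b2 + e3 * (b2 + t - b1) \<le> (b2 + t) * (b2 + b3) + y"
proof -
  define u where "u = max 0 (b2 - b1)"
  have y: "y = b1 * b2 \<or> e2 * b2 = e2 * u + y"
    using y by (auto simp: u_def min_def max_def algebra_simps)
  \<comment> \<open>This is \<open>W22\<close> multiplied by \<open>q / (b1 + b2)\<close>, with the coefficient of \<open>e3\<close> lowered to \<open>r\<close>.\<close>
  have scale: "e2 * q + e3 * r \<le> q * (b1 + b2)"
    if "0 \<le> q" "(b1 + b2) * r \<le> q * max 0 (b1 + b2 - b3)" for q r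
  proof -
    have "(b1 + b2) * (e2 * q + e3 * r) = q * (e2 * (b1 + b2)) + e3 * ((b1 + b2) * r)"
      by (simp add: algebra_simps)
    also have "\<dots> \<le> q * (e2 * (b1 + b2)) + e3 * (q * max 0 (b1 + b2 - b3))"
      using that pos by (intro add_left_mono mult_left_mono) auto
    also have "\<dots> = q * (e2 * (b1 + b2) + e3 * max 0 (b1 + b2 - b3))"
      by (simp add: algebra_simps)
    also have "\<dots> \<le> q * ((b1 + b2) * (b1 + b2))"
      using W22 that by (intro mult_left_mono) auto
    finally have "(b1 + b2) * (e2 * q + e3 * r) \<le> (b1 + b2) * (q * (b1 + b2))"
      by (simp add: algebra_simps)
    then show ?thesis using pos by simp
  qed
  show g0: "e2 * b2 + e3 * max 0 (b2 - b3) \<le> b2 * (b1 + b2)"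
  proof (rule scale)
    have "(b2 - b3) * (b1 + b2) \<le> b2 * (b1 + b2 - b3)"
      using pos by (simp add: algebra_simps)
    then show "(b1 + b2) * max 0 (b2 - b3) \<le> b2 * max 0 (b1 + b2 - b3)"
      using pos by (cases "b3 \<le> b2") (simp_all add: algebra_simps)
  qed (use pos in simp)
  show "e2 * b2 + e3 * max 0 (b2 - b1 - b3) \<le> b2 * b2 + y"
    using y
  proof
    assume y: "y = b1 * b2"
    have "e3 * max 0 (b2 - b1 - b3) \<le> e3 * max 0 (b2 - b3)"
      using pos by (intro mult_left_mono) auto
    then show ?thesis using g0 by (simp add: y algebra_simps)
  next
    assume y: "e2 * b2 = e2 * u + y"
    have "e2 * u + e3 * max 0 (b2 - b1 - b3) \<le> u * (b1 + b2)"
    proof (rule scale)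
      have "(b2 - b1 - b3) * (b1 + b2) \<le> (b2 - b1) * (b1 + b2 - b3)"
        using pos by (simp add: algebra_simps)
      then show "(b1 + b2) * max 0 (b2 - b1 - b3) \<le> u * max 0 (b1 + b2 - b3)"
        using pos by (cases "b1 + b3 \<le> b2") (simp_all add: u_def algebra_simps)
    qed (simp add: u_def)
    moreover have "u * (b1 + b2) \<le> b2 * b2"
      using pos by (auto simp: u_def max_def algebra_simps)
    ultimately show ?thesis using y by simp
  qed

  assume t: "0 \<le> t" "t \<le> b3"
  show "e2 * b2 + e3 * (b2 + t - b1) \<le> (b2 + t) * (b2 + b3) + y"
    using y
  proof
    assume y: "y = b1 * b2"
    have b2W: "b2 * (e2 + e3) \<le> b2 * (b1 + b2 + b3)"
      using W23 pos by (intro mult_left_mono) auto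
    show ?thesis
    proof (cases "b1 \<le> t")
      case True
      have "(t - b1) * e3 \<le> (t - b1) * (b1 + b2 + b3)"
        using W23 True pos by (intro mult_left_mono) auto
      moreover have "0 \<le> b1 * (b1 + b3 - t)" "0 \<le> b1 * b2" using pos t by simp_all
      ultimately show ?thesis using b2W y by (simp only: algebra_simps; linarith)
    next
      case False
      then have "0 \<le> e3 * (b1 - t)" "0 \<le> t * (b2 + b3)" using pos t by simp_all
      then show ?thesis using b2W y by (simp only: algebra_simps; linarith)
    qed
  next
    assume y: "e2 * b2 = e2 * u + y"
    have "e2 * u + e3 * (b2 + t - b1) \<le> (b2 + t) * (b2 + b3)"
    proof (cases "b2 + t \<le> b1")
      case True
      then have "u = 0" using t by (simp add: u_def)
      moreover have "e3 * (b2 + t - b1) \<le> 0" using True pos by (simp add: mult_nonneg_nonpos)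
      moreover have "0 \<le> (b2 + t) * (b2 + b3)" using pos t by simp
      ultimately show ?thesis by simp
    next
      case False
      have "e2 * u \<le> e2 * (b2 + t - b1)"
        using False t pos by (intro mult_left_mono) (auto simp: u_def)
      moreover have "(b2 + t - b1) * (e2 + e3) \<le> (b2 + t - b1) * (b1 + b2 + b3)"
        using W23 False by (intro mult_left_mono) auto
      moreover have "0 \<le> b1 * (b1 + b3 - t)" using pos t by simp
      ultimately show ?thesis by (simp only: algebra_simps; linarith)
    qed
    then show ?thesis using y by simp
  qed
qed

section \<open>Cuts of the third layer\<close>

text \<open>
  For symmetric capacities and equal supplies and demands, the condition for the cut \<open>I \<times> J\<close> is that
  its capacity is at least \<open>s(I) + s(J) - s({1, 2, 3})\<close>, which is symmetric in \<open>I\<close> and \<open>J\<close>. It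
  holds trivially if \<open>I\<close> and \<open>J\<close> are disjoint. If they cover everything, the required capacity is
  \<open>s(I \<inter> J)\<close>, and the full rows provide it. What remains up to exchanging \<open>I\<close> and \<open>J\<close> is \<open>I = J\<close> or
  a singleton inside a pair.
\<close>

lemma symmetric_cuts_3:
  fixes C :: "nat \<times> nat \<Rightarrow> int" and s :: "nat \<Rightarrow> int"
  assumes "C (2, 1) = C (1, 2)" "C (3, 1) = C (1, 3)" "C (3, 2) = C (2, 3)"
    and s: "\<forall>i\<in>{1,2,3}. 0 \<le> s i" and C: "\<forall>i\<in>{1,2,3}. \<forall>j\<in>{1,2,3}. 0 \<le> C (i, j)"
    and "s 1 \<le> C (1, 1) + s 2 + s 3"
    and "s 2 \<le> C (2, 2) + s 1 + s 3"
    and "s 3 \<le> C (3, 3) + s 1 + s 2"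
    and "s 1 \<le> C (1, 1) + C (1, 2) + s 3"
    and "s 2 \<le> C (1, 2) + C (2, 2) + s 3"
    and "s 1 \<le> C (1, 1) + C (1, 3) + s 2"
    and "s 3 \<le> C (1, 3) + C (3, 3) + s 2"
    and "s 2 \<le> C (2, 2) + C (2, 3) + s 1"
    and "s 3 \<le> C (2, 3) + C (3, 3) + s 1"
    and "s 1 \<le> C (1, 1) + C (1, 2) + C (1, 3)"
    and "s 2 \<le> C (1, 2) + C (2, 2) + C (2, 3)"
    and "s 3 \<le> C (1, 3) + C (2, 3) + C (3, 3)"
    and "s 1 + s 2 \<le> C (1, 1) + 2 * C (1, 2) + C (2, 2) + s 3"
    and "s 1 + s 3 \<le> C (1, 1) + 2 * C (1, 3) + C (3, 3) + s 2"
    and "s 2 + s 3 \<le> C (2, 2) + 2 * C (2, 3) + C (3, 3) + s 1"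
    and I: "I \<subseteq> {1,2,3}" and J: "J \<subseteq> {1,2,3}"
  shows "sum s I \<le> sum C (I \<times> J) + sum s ({1,2,3} - J)"
proof -
  have eight: "K \<in> {{}, {1}, {2}, {3}, {1,2}, {1,3}, {2,3}, {1,2,3}}"
    if "K \<subseteq> {1,2,3}" for K :: "nat set"
  proof -
    have "K \<in> Pow {1,2,3}" using that by simp
    also have "\<dots> = {{}, {1}, {2}, {3}, {1,2}, {1,3}, {2,3}, {1,2,3}}"
      unfolding Pow_insert Pow_empty by (simp add: insert_commute del: One_nat_def)
    finally show ?thesis .
  qed
  have "0 \<le> s 1" "0 \<le> s 2" "0 \<le> s 3" "0 \<le> C (1, 1)" "0 \<le> C (1, 2)" "0 \<le> C (1, 3)"
    "0 \<le> C (2, 2)" "0 \<le> C (2, 3)" "0 \<le> C (3, 3)"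
    using s C by (simp_all del: One_nat_def)
  note facts = this assms(6-20)
  have cut: "(\<Sum>i\<in>I. s i) \<le> (\<Sum>i\<in>I. \<Sum>j\<in>J. C (i, j)) + (\<Sum>j\<in>{1,2,3} - J. s j)"
    using eight[OF I] eight[OF J] unfolding insert_iff
    by (elim disjE; simp add: insert_Diff_if assms(1-3) del: One_nat_def; (use facts in linarith)?)
  then show ?thesis
    by (simp add: sum.cartesian_product)
qed

text \<open>
  Here \<open>C\<close> is the capacity that the first two layers leave to the third. The chosen \<open>y\<close> is the
  largest value that keeps layer 2 nonnegative and \<open>C (1, 2)\<close> nonnegative.
\<close>

lemma third_layer_cut:
  fixes C :: "nat \<times> nat \<Rightarrow> int" and b :: "nat \<Rightarrow> int"
  assumes pos: "0 < b 1" "0 < b 2" "0 < b 3" "0 \<le> e1" "0 \<le> e2" "0 \<le> e3"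
    and W13: "e1 + e2 + e3 \<le> b 1 + b 2 + b 3"
    and W11: "e1 * b 1 + e2 * max 0 (b 1 - b 2) + e3 * max 0 (b 1 - b 2 - b 3) \<le> b 1 * b 1"
    and W12: "(e1 + e2) * b 1 + e3 * max 0 (b 1 - b 3) \<le> b 1 * (b 1 + b 2)"
    and W22: "e1 * b 1 + e2 * (b 1 + b 2) + e3 * max 0 (b 1 + b 2 - b 3)
      \<le> (b 1 + b 2) * (b 1 + b 2)"
    and y: "y = min (b 1 * b 2) (e2 * min (b 1) (b 2))"
    and C: "C (1, 1) = b 1 * b 1 - (e1 + e2) * b 1 + y"
      "C (1, 2) = b 1 * b 2 - y" "C (2, 1) = b 1 * b 2 - y"
      "C (2, 2) = b 2 * b 2 - e2 * b 2 + y"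
      "C (1, 3) = b 1 * b 3" "C (3, 1) = b 1 * b 3"
      "C (2, 3) = b 2 * b 3" "C (3, 2) = b 2 * b 3" "C (3, 3) = b 3 * b 3"
  shows "\<forall>i\<in>{1,2,3}. \<forall>j\<in>{1,2,3}. 0 \<le> C (i, j)"
    and "I \<subseteq> {1,2,3} \<Longrightarrow> J \<subseteq> {1,2,3} \<Longrightarrow>
      (\<Sum>i\<in>I. e3 * b i) \<le> sum C (I \<times> J) + (\<Sum>j\<in>{1,2,3} - J. e3 * b j)"
proof -
  have y_cases: "y = b 1 * b 2 \<or> y = e2 * min (b 1) (b 2)"
    using y by (auto simp: min_def)
  have "0 \<le> e1 * b 1" using pos by simp
  then have W22': "e2 * (b 1 + b 2) + e3 * max 0 (b 1 + b 2 - b 3) \<le> (b 1 + b 2) * (b 1 + b 2)"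
    using W22 by linarith
  have W23: "e2 + e3 \<le> b 1 + b 2 + b 3" using W13 pos by simp
  note first = first_step_bounds[OF pos W13 W11 W12 y_cases]
  note second = second_step_bounds[OF pos(1-3,5,6) W23 W22' y_cases]
  have drop_max: "l + e3 * r \<le> u" "l \<le> u" if "l + e3 * max 0 r \<le> u" for l r u
  proof -
    have "e3 * r \<le> e3 * max 0 r" "0 \<le> e3 * max 0 r"
      using pos by (auto intro: mult_left_mono)
    then show "l + e3 * r \<le> u" "l \<le> u" using that by linarith+
  qed
  \<comment> \<open>For \<open>x = b 1 + b 2\<close>, \<open>x = b 2\<close>, \<open>x = b 1\<close> these are the cuts \<open>{3} \<times> {3}\<close>, \<open>{3} \<times> {1, 3}\<close> and
    \<open>{3} \<times> {2, 3}\<close>.\<close>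
  have third: "e3 * (b 3 - x) \<le> b 3 * (b 1 + b 2 + b 3 - x)"
    if "0 \<le> x" "x \<le> b 1 + b 2 + b 3" for x
  proof (cases "x \<le> b 3")
    case True
    have "e3 * (b 3 - x) \<le> (b 1 + b 2 + b 3) * (b 3 - x)"
      using True W13 pos by (intro mult_right_mono) auto
    moreover have "0 \<le> x * (b 1 + b 2)" using that pos by simp
    ultimately show ?thesis by (simp only: algebra_simps; linarith)
  next
    case False
    then have "e3 * (b 3 - x) \<le> 0" "0 \<le> b 3 * (b 1 + b 2 + b 3 - x)"
      using that pos by (simp_all add: mult_nonneg_nonpos)
    then show ?thesis by linarith
  qed
  have rows: "b 1 * (e1 + e2 + e3) \<le> b 1 * (b 1 + b 2 + b 3)"
    "b 2 * (e2 + e3) \<le> b 2 * (b 1 + b 2 + b 3)"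
    "b 3 * e3 \<le> b 3 * (b 1 + b 2 + b 3)"
    using W13 pos by (auto intro!: mult_left_mono)
  have y_le: "y \<le> b 1 * b 2" using y by simp
  show nonneg: "\<forall>i\<in>{1,2,3}. \<forall>j\<in>{1,2,3}. 0 \<le> C (i, j)"
    using drop_max(2)[OF first(1)] drop_max(2)[OF second(2)] y_le pos
    by (auto simp: C simp del: One_nat_def)
  assume IJ: "I \<subseteq> {1,2,3}" "J \<subseteq> {1,2,3}"
  show "(\<Sum>i\<in>I. e3 * b i) \<le> sum C (I \<times> J) + (\<Sum>j\<in>{1,2,3} - J. e3 * b j)"
  proof (rule symmetric_cuts_3[OF _ _ _ _ nonneg _ _ _ _ _ _ _ _ _ _ _ _ _ _ _ IJ])
    show "e3 * b 1 \<le> C (1, 1) + e3 * b 2 + e3 * b 3"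
      using drop_max(1)[OF first(1)] unfolding C by (simp only: algebra_simps; linarith)
    show "e3 * b 2 \<le> C (2, 2) + e3 * b 1 + e3 * b 3"
      using drop_max(1)[OF second(2)] unfolding C by (simp only: algebra_simps; linarith)
    show "e3 * b 3 \<le> C (3, 3) + e3 * b 1 + e3 * b 2"
      using third[of "b 1 + b 2"] pos unfolding C by (simp add: algebra_simps)
    show "e3 * b 1 \<le> C (1, 1) + C (1, 2) + e3 * b 3"
      using drop_max(1)[OF W12] unfolding C by (simp only: algebra_simps; linarith)
    show "e3 * b 2 \<le> C (1, 2) + C (2, 2) + e3 * b 3"
      using drop_max(1)[OF second(1)] unfolding C by (simp only: algebra_simps; linarith)
    show "e3 * b 1 \<le> C (1, 1) + C (1, 3) + e3 * b 2"
      using first(2)[of 0] pos unfolding C by (simp add: algebra_simps)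
    show "e3 * b 3 \<le> C (1, 3) + C (3, 3) + e3 * b 2"
      using third[of "b 2"] pos unfolding C by (simp add: algebra_simps)
    show "e3 * b 2 \<le> C (2, 2) + C (2, 3) + e3 * b 1"
      using second(3)[of 0] pos unfolding C by (simp add: algebra_simps)
    show "e3 * b 3 \<le> C (2, 3) + C (3, 3) + e3 * b 1"
      using third[of "b 1"] pos unfolding C by (simp add: algebra_simps)
    show "e3 * b 1 \<le> C (1, 1) + C (1, 2) + C (1, 3)"
      using rows(1) unfolding C by (simp only: algebra_simps; linarith)
    show "e3 * b 2 \<le> C (1, 2) + C (2, 2) + C (2, 3)"
      using rows(2) unfolding C by (simp only: algebra_simps; linarith)
    show "e3 * b 3 \<le> C (1, 3) + C (2, 3) + C (3, 3)"
      using rows(3) unfolding C by (simp only: algebra_simps; linarith)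
    show "e3 * b 1 + e3 * b 2 \<le> C (1, 1) + 2 * C (1, 2) + C (2, 2) + e3 * b 3"
      using drop_max(1)[OF W22] unfolding C by (simp only: algebra_simps; linarith)
    show "e3 * b 1 + e3 * b 3 \<le> C (1, 1) + 2 * C (1, 3) + C (3, 3) + e3 * b 2"
      using first(2)[of "b 3"] pos unfolding C by (simp add: algebra_simps)
    show "e3 * b 2 + e3 * b 3 \<le> C (2, 2) + 2 * C (2, 3) + C (3, 3) + e3 * b 1"
      using second(3)[of "b 3"] pos unfolding C by (simp add: algebra_simps)
  qed (use pos in \<open>simp_all add: C del: One_nat_def\<close>)
qed

section \<open>The allocation\<close>

text \<open>
  The third layer is obtained from \<open>integral_transport_exists\<close>. Supplies and capacities are handled as
  integers, so that the truncated subtractions in the rectangle bounds turn into maxima with \<open>0\<close>.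
\<close>

lemma allocation_exists_if_rectangle_bounds:
  fixes a e :: "nat \<Rightarrow> nat"
  assumes a: "0 < a 1" "a 1 < a 2" "a 2 < a 3"
    and bound: "\<And>w v. (\<Sum>i\<in>{1,2,3}. e i * (min w (a i) + min v (a i) - a i)) \<le> w * v"
  shows "\<exists>z. is_allocation 3 a e z"
proof -
  define b where "b = row_step a"
  have b: "b 1 = a 1" "b 2 = a 2 - a 1" "b 3 = a 3 - a 2"
    by (simp_all add: b_def row_step_def)
  have b_pos: "0 < b 1" "0 < b 2" "0 < b 3" using a by (simp_all add: b del: One_nat_def)
  have a_b: "a 1 = b 1" "a 2 = b 1 + b 2" "a 3 = b 1 + b 2 + b 3"
    using a by (simp_all add: b del: One_nat_def)
  let ?b = "\<lambda>j. int (b j)"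
  have trunc: "int (m - n) = max 0 (int m - int n)" for m n by simp
  have bound_b: "e 1 * (min w (b 1) + min v (b 1) - b 1)
      + e 2 * (min w (b 1 + b 2) + min v (b 1 + b 2) - (b 1 + b 2))
      + e 3 * (min w (b 1 + b 2 + b 3) + min v (b 1 + b 2 + b 3) - (b 1 + b 2 + b 3)) \<le> w * v" for w v
    using bound[of w v] by (simp add: a_b add.assoc del: One_nat_def)
  have W11: "int (e 1) * ?b 1 + int (e 2) * max 0 (?b 1 - ?b 2)
      + int (e 3) * max 0 (?b 1 - ?b 2 - ?b 3) \<le> ?b 1 * ?b 1"
  proof -
    have "e 1 * b 1 + e 2 * (b 1 - b 2) + e 3 * (b 1 - (b 2 + b 3)) \<le> b 1 * b 1"
      using bound_b[of "b 1" "b 1"] by (simp add: min_absorb1 del: One_nat_def)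
    from this[folded of_nat_le_iff[where 'a = int]] show ?thesis
      by (simp only: of_nat_add of_nat_mult trunc diff_diff_eq)
  qed
  have W12: "(int (e 1) + int (e 2)) * ?b 1 + int (e 3) * max 0 (?b 1 - ?b 3)
      \<le> ?b 1 * (?b 1 + ?b 2)"
  proof -
    have "e 1 * b 1 + e 2 * b 1 + e 3 * (b 1 - b 3) \<le> b 1 * (b 1 + b 2)"
      using bound_b[of "b 1" "b 1 + b 2"] by (simp add: min_absorb1 min_absorb2 del: One_nat_def)
    from this[folded of_nat_le_iff[where 'a = int]] show ?thesis
      by (simp only: of_nat_add of_nat_mult trunc distrib_right)
  qed
  have W22: "int (e 1) * ?b 1 + int (e 2) * (?b 1 + ?b 2) + int (e 3) * max 0 (?b 1 + ?b 2 - ?b 3)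
      \<le> (?b 1 + ?b 2) * (?b 1 + ?b 2)"
  proof -
    have "e 1 * b 1 + e 2 * (b 1 + b 2) + e 3 * (b 1 + b 2 - b 3) \<le> (b 1 + b 2) * (b 1 + b 2)"
      using bound_b[of "b 1 + b 2" "b 1 + b 2"] by (simp add: min_absorb1 min_absorb2 del: One_nat_def)
    from this[folded of_nat_le_iff[where 'a = int]] show ?thesis
      by (simp only: of_nat_add of_nat_mult trunc)
  qed
  \<comment> \<open>For \<open>w = 1\<close> and \<open>v = a 3\<close> every row contributes exactly \<open>1\<close>.\<close>
  have W13: "int (e 1) + int (e 2) + int (e 3) \<le> ?b 1 + ?b 2 + ?b 3"
    using bound_b[of 1 "b 1 + b 2 + b 3"] b_pos by (simp add: min_absorb1 min_absorb2 Suc_leI)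

  define y where "y = min (b 1 * b 2) (e 2 * min (b 1) (b 2))"
  have y_le: "y \<le> b 1 * b 2" "y \<le> e 2 * b 1" "y \<le> e 2 * b 2"
    by (auto simp: y_def min_le_iff_disj)
  \<comment> \<open>The second layer; only \<open>j, k \<le> 2\<close> is meaningful.\<close>
  define z2 where "z2 j k = (if j \<noteq> k then y else e 2 * b j - y)" for j k :: nat
  define C where "C = (\<lambda>(j, k). int (b j * b k) - (if j = 3 \<or> k = 3 then 0
      else int (z2 j k) + (if j = 1 \<and> k = 1 then int (e 1 * b 1) else 0)))"
  have C_simps: "C (1, 1) = ?b 1 * ?b 1 - (int (e 1) + int (e 2)) * ?b 1 + int y"
      "C (1, 2) = ?b 1 * ?b 2 - int y" "C (2, 1) = ?b 1 * ?b 2 - int y"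
      "C (2, 2) = ?b 2 * ?b 2 - int (e 2) * ?b 2 + int y"
      "C (1, 3) = ?b 1 * ?b 3" "C (3, 1) = ?b 1 * ?b 3"
      "C (2, 3) = ?b 2 * ?b 3" "C (3, 2) = ?b 2 * ?b 3" "C (3, 3) = ?b 3 * ?b 3"
    using y_le by (simp_all add: C_def z2_def of_nat_diff algebra_simps del: One_nat_def)
  have y_int: "int y = min (?b 1 * ?b 2) (int (e 2) * min (?b 1) (?b 2))"
    by (simp add: y_def of_nat_min)
  note cut = third_layer_cut[of ?b "int (e 1)" "int (e 2)" "int (e 3)" "int y" C,
      OF _ _ _ _ _ _ W13 W11 W12 W22 y_int C_simps]
  have C_nonneg: "0 \<le> C (j, k)" if "j \<in> {1,2,3}" "k \<in> {1,2,3}" for j k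
    using cut(1) b_pos that by (auto simp del: One_nat_def)
  have "\<exists>x. (\<forall>j\<in>{1,2,3}. \<forall>k\<in>{1,2,3}. x j k \<le> nat (C (j, k))) \<and>
      (\<forall>j\<in>{1,2,3}. int (\<Sum>k\<in>{1,2,3}. x j k) = int (e 3) * ?b j) \<and>
      (\<forall>k\<in>{1,2,3}. int (\<Sum>j\<in>{1,2,3}. x j k) = int (e 3) * ?b k)"
  proof (intro integral_transport_exists)
    fix I J :: "nat set" assume IJ: "I \<subseteq> {1,2,3}" "J \<subseteq> {1,2,3}"
    have "int (\<Sum>p\<in>I \<times> J. nat (C p)) = sum C (I \<times> J)"
      using IJ C_nonneg by (auto simp: subset_iff intro!: sum.cong)
    then show "(\<Sum>j\<in>I. int (e 3) * ?b j) \<le> int (\<Sum>p\<in>I \<times> J. nat (C p))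
        + (\<Sum>k\<in>{1,2,3} - J. int (e 3) * ?b k)"
      using cut(2)[OF _ _ _ _ _ _ IJ] b_pos by simp
  qed simp_all
  then obtain x where x_le: "\<And>j k. j \<in> {1,2,3} \<Longrightarrow> k \<in> {1,2,3} \<Longrightarrow> x j k \<le> nat (C (j, k))"
    and x_row: "\<And>j. j \<in> {1,2,3} \<Longrightarrow> int (\<Sum>k\<in>{1,2,3}. x j k) = int (e 3) * ?b j"
    and x_col: "\<And>k. k \<in> {1,2,3} \<Longrightarrow> int (\<Sum>j\<in>{1,2,3}. x j k) = int (e 3) * ?b k"
    by blast
  have x_C: "int (x j k) \<le> C (j, k)" if "j \<in> {1,2,3}" "k \<in> {1,2,3}" for j k
    using x_le[OF that] C_nonneg[OF that] by simp
  have x_row: "(\<Sum>k\<in>{1,2,3}. x j k) = e 3 * b j" if "j \<in> {1,2,3}" for j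
    using x_row[OF that] by (metis of_nat_eq_iff of_nat_mult)
  have x_col: "(\<Sum>j\<in>{1,2,3}. x j k) = e 3 * b k" if "k \<in> {1,2,3}" for k
    using x_col[OF that] by (metis of_nat_eq_iff of_nat_mult)
  define z where "z i j k = (if i = 1 then e 1 * b 1 else if i = 2 then z2 j k else x j k)"
    for i j k :: nat
  have up_to: "{1..1} = {1::nat}" "{1..2} = {1,2::nat}" "{1..3} = {1,2,3::nat}"
    "{2..3} = {2,3::nat}" "{3..3} = {3::nat}"
    by auto
  have "is_allocation 3 a e z"
    unfolding is_allocation_def b_def[symmetric]
  proof (intro conjI allI impI)
    fix i j assume "1 \<le> j \<and> j \<le> i \<and> i \<le> (3::nat)"
    moreover from this have "i = 1 \<and> j = 1 \<or> i = 2 \<and> (j = 1 \<or> j = 2) \<or> i = 3 \<and> j \<in> {1,2,3}"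
      by auto
    ultimately show "(\<Sum>k = 1..i. z i j k) = e i * b j"
      using x_row[of j] y_le by (elim disjE conjE) (simp_all add: up_to z_def z2_def del: One_nat_def)
  next
    fix i k assume "1 \<le> k \<and> k \<le> i \<and> i \<le> (3::nat)"
    moreover from this have "i = 1 \<and> k = 1 \<or> i = 2 \<and> (k = 1 \<or> k = 2) \<or> i = 3 \<and> k \<in> {1,2,3}"
      by auto
    ultimately show "(\<Sum>j = 1..i. z i j k) = e i * b k"
      using x_col[of k] y_le by (elim disjE conjE) (simp_all add: up_to z_def z2_def del: One_nat_def)
  next
    fix j k assume "1 \<le> j \<and> j \<le> (3::nat) \<and> 1 \<le> k \<and> k \<le> (3::nat)"
    then have mem: "j \<in> {1,2,3}" "k \<in> {1,2,3}" by auto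
    have "int (\<Sum>i = max j k..3. z i j k) = int (b j * b k) - C (j, k) + int (x j k)"
      using mem by (auto simp: up_to z_def C_def max_def simp del: One_nat_def)
    then have "int (\<Sum>i = max j k..3. z i j k) \<le> int (b j * b k)"
      using x_C[OF mem] by linarith
    then show "(\<Sum>i = max j k..3. z i j k) \<le> b j * b k"
      by (simp only: of_nat_le_iff)
  qed
  then show ?thesis by blast
qed

theorem theorem14:
  fixes a e :: "nat \<Rightarrow> nat" and Y :: "nat list"
  assumes "0 < a 1" and "a 1 < a 2" and "a 2 < a 3"
    and "e 1 \<ge> 1" and "e 2 \<ge> 1" and "e 3 \<ge> 1"
    and "young_diagram Y"
    and "mset Y = (\<Sum>i=1..3. replicate_mset (e i) (a i))"
    and "wide Y"
  shows "\<exists>z. is_allocation 3 a e z"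
proof (rule allocation_exists_if_rectangle_bounds[OF assms(1-3)])
  fix w v
  have three: "{1..3} = {1,2,3::nat}" by auto
  have "(\<Sum>r\<leftarrow>Y. f r) = (\<Sum>i\<in>{1,2,3}. e i * f (a i))" for f :: "nat \<Rightarrow> nat"
    using assms(8) unfolding three by (simp flip: sum_mset_sum_list add: image_replicate_mset)
  then show "(\<Sum>i\<in>{1,2,3}. e i * (min w (a i) + min v (a i) - a i)) \<le> w * v"
    using wide_rectangle_bound[OF assms(7,9), of w v] by simp
qed

end
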